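(* Let $T$ be a tree of order $n\ge4$ which is not isomorphic to the star $K_{1,n-1}$. Then $\xi_n(T^c)\ge\xi_n\big((T_{n,3}^{0,n-4})^c\big)$, with equality if and only if $T\cong T_{n,3}^{0,n-4}$.
   Context: For a connected graph $G$ on $n$ vertices, the eccentricity matrix $\mathcal{E}(G)$ is the matrix indexed by $V(G)$ whose $(u,v)$-entry is $d_G(u,v)$ if $d_G(u,v)=\min\{e_G(u),e_G(v)\}$ and $0$ otherwise, where $d_G$ is the graph distance and $e_G(u)=\max_v d_G(u,v)$. $\xi_n(G)$ denotes the least eigenvalue of $\mathcal{E}(G)$. $T^c$ is the complement of $T$. $T_{n,3}^{0,n-4}$ is the tree on $n$ vertices obtained from the path $v_0v_1v_2v_3$ by attaching $n-4$ pendant vertices to $v_2$. *)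

theory Defs
  imports "Graph_Theory.Graph_Theory" "Jordan_Normal_Form.Char_Poly"
begin

text \<open>
  A finite simple graph is a \<^locale>\<open>pair_graph\<close>: a finite, symmetric, loop-free set of
  ordered pairs of vertices. Every edge is thus a pair of opposite arcs, which form a
  \<^const>\<open>pre_digraph.cycle\<close> of length 2, so that the library's \<^const>\<open>tree\<close> excludes all
  symmetric digraphs with an edge. The cycles of the undirected graph are those of length at
  least 3.
\<close>

definition undirected_tree :: "'a pair_pre_digraph \<Rightarrow> bool" where
  "undirected_tree G \<longleftrightarrow>
     pair_graph G \<and> connected G \<and> \<not> (\<exists>p. pre_digraph.cycle G p \<and> length p \<ge> 3)"

definition graph_complement :: "'a pair_pre_digraph \<Rightarrow> 'a pair_pre_digraph" where
  "graph_complement G =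
     \<lparr> pverts = pverts G,
       parcs = {(u, v). u \<in> pverts G \<and> v \<in> pverts G \<and> u \<noteq> v \<and> (u, v) \<notin> parcs G} \<rparr>"

lemma pair_graph_graph_complement:
  assumes "pair_graph G"
  shows "pair_graph (graph_complement G)"
proof -
  interpret pair_graph G by fact
  have "finite {(u, v). u \<in> pverts G \<and> v \<in> pverts G \<and> u \<noteq> v \<and> (u, v) \<notin> parcs G}"
    by (rule finite_subset[of _ "pverts G \<times> pverts G"]) (auto simp: pair_finite_verts)
  then show ?thesis
    using pair_sym_arcs pair_finite_verts
    by unfold_locales (auto simp: graph_complement_def symmetric_def sym_def)
qed

text \<open>
  The distance is \<^term>\<open>real_of_ereal \<infinity> = 0\<close> between vertices that are not joined by a walk;
  the notions below are meant for connected graphs.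
\<close>

definition graph_dist :: "'a pair_pre_digraph \<Rightarrow> 'a \<Rightarrow> 'a \<Rightarrow> real" where
  "graph_dist G u v = real_of_ereal (wf_digraph.\<mu> G (\<lambda>_. 1) u v)"

definition eccentricity :: "'a pair_pre_digraph \<Rightarrow> 'a \<Rightarrow> real" where
  "eccentricity G u = Max (graph_dist G u ` pverts G)"

definition ecc_entry :: "'a pair_pre_digraph \<Rightarrow> 'a \<Rightarrow> 'a \<Rightarrow> real" where
  "ecc_entry G u v =
     (if graph_dist G u v = min (eccentricity G u) (eccentricity G v)
      then graph_dist G u v else 0)"

text \<open>
  Matrices are indexed by \<open>0, \<dots>, n - 1\<close>, so the eccentricity matrix is taken with respect to an
  enumeration of the vertices. Its eigenvalues do not depend on the enumeration
  (\<open>eigenvalue_ecc_matrix_enum\<close>).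
\<close>

definition vertex_enum :: "'a pair_pre_digraph \<Rightarrow> 'a list \<Rightarrow> bool" where
  "vertex_enum G xs \<longleftrightarrow> distinct xs \<and> set xs = pverts G"

definition ecc_matrix_enum :: "'a pair_pre_digraph \<Rightarrow> 'a list \<Rightarrow> real mat" where
  "ecc_matrix_enum G xs = mat (length xs) (length xs) (\<lambda>(i, j). ecc_entry G (xs ! i) (xs ! j))"

definition ecc_matrix :: "'a pair_pre_digraph \<Rightarrow> real mat" where
  "ecc_matrix G = ecc_matrix_enum G (SOME xs. vertex_enum G xs)"

definition least_ecc_eigenvalue :: "'a pair_pre_digraph \<Rightarrow> real" where
  "least_ecc_eigenvalue G = Min {k. eigenvalue (ecc_matrix G) k}"

lemma eigenvalue_ecc_matrix_enum_perm:
  assumes xs: "vertex_enum G xs" and ys: "vertex_enum G ys"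
    and ev: "eigenvalue (ecc_matrix_enum G xs) k"
  shows "eigenvalue (ecc_matrix_enum G ys) k"
proof -
  define n where "n = length xs"
  have n: "length ys = n"
    using xs ys unfolding n_def vertex_enum_def by (metis distinct_card)
  have dx: "distinct xs" and dy: "distinct ys" and st: "set xs = set ys"
    using xs ys by (auto simp: vertex_enum_def)
  have bx: "bij_betw ((!) xs) {..<n} (set ys)" and yb: "bij_betw ((!) ys) {..<n} (set ys)"
    using bij_betw_nth[OF dx, of "{..<n}" "set ys"] bij_betw_nth[OF dy, of "{..<n}" "set ys"] st n
    by (auto simp: n_def)
  define s where "s = the_inv_into {..<n} ((!) xs) \<circ> (!) ys"
  have bs: "bij_betw s {..<n} {..<n}"
    unfolding s_def by (rule bij_betw_trans[OF yb bij_betw_the_inv_into[OF bx]])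
  have xs_s: "xs ! s i = ys ! i" if "i < n" for i
  proof -
    have "ys ! i \<in> (!) xs ` {..<n}"
      using that bij_betw_imp_surj_on[OF bx] n by auto
    then show ?thesis
      using f_the_inv_into_f[OF bij_betw_imp_inj_on[OF bx]] by (auto simp: s_def)
  qed
  have s_lt: "s i < n" if "i < n" for i
    using bs that bij_betwE by blast
  from ev obtain v where v: "v \<in> carrier_vec n" "v \<noteq> 0\<^sub>v n"
      and eq: "ecc_matrix_enum G xs *\<^sub>v v = k \<cdot>\<^sub>v v"
    by (auto simp: eigenvalue_def eigenvector_def ecc_matrix_enum_def n_def)
  have eq': "(\<Sum>j<n. ecc_entry G (xs ! i) (xs ! j) * v $ j) = k * v $ i" if "i < n" for i
  proof -
    have "(ecc_matrix_enum G xs *\<^sub>v v) $ i = (k \<cdot>\<^sub>v v) $ i" using eq by simp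
    then show ?thesis
      using that v
      by (simp add: ecc_matrix_enum_def scalar_prod_def n_def[symmetric] lessThan_atLeast0)
  qed
  define w where "w = vec n (\<lambda>i. v $ s i)"
  have "\<exists>i<n. v $ i \<noteq> 0"
    using v by (metis carrier_vecD eq_vecI index_zero_vec)
  then have "\<exists>i<n. w $ i \<noteq> 0"
    using bij_betw_imp_surj_on[OF bs] unfolding w_def
    by (smt (verit) image_iff index_vec lessThan_iff)
  then have w0: "w \<noteq> 0\<^sub>v n" by auto
  have "ecc_matrix_enum G ys *\<^sub>v w = k \<cdot>\<^sub>v w"
  proof (rule eq_vecI)
    fix i assume "i < dim_vec (k \<cdot>\<^sub>v w)"
    then have i: "i < n" by (simp add: w_def)
    have "(ecc_matrix_enum G ys *\<^sub>v w) $ i = (\<Sum>j<n. ecc_entry G (ys ! i) (ys ! j) * w $ j)"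
      using i n by (simp add: ecc_matrix_enum_def scalar_prod_def w_def lessThan_atLeast0)
    also have "\<dots> = (\<Sum>j<n. ecc_entry G (xs ! s i) (xs ! s j) * v $ s j)"
      using i by (intro sum.cong) (auto simp: xs_s w_def)
    also have "\<dots> = (\<Sum>j<n. ecc_entry G (xs ! s i) (xs ! j) * v $ j)"
      by (rule sum.reindex_bij_betw[OF bs])
    also have "\<dots> = k * v $ s i" using eq' s_lt i by blast
    finally show "(ecc_matrix_enum G ys *\<^sub>v w) $ i = (k \<cdot>\<^sub>v w) $ i"
      using i by (simp add: w_def)
  qed (use n in \<open>simp add: ecc_matrix_enum_def w_def\<close>)
  with w0 n show ?thesis
    unfolding eigenvalue_def eigenvector_def
    by (intro exI[of _ w]) (auto simp: ecc_matrix_enum_def w_def)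
qed

lemma eigenvalue_ecc_matrix_enum:
  assumes "vertex_enum G xs"
  shows "eigenvalue (ecc_matrix G) k \<longleftrightarrow> eigenvalue (ecc_matrix_enum G xs) k"
  using eigenvalue_ecc_matrix_enum_perm assms someI[of "vertex_enum G" xs]
  unfolding ecc_matrix_def by blast

text \<open>
  The tree \<open>T\<^sub>n\<^sub>,\<^sub>3\<close> with superscript \<open>(0, n - 4)\<close>, for \<open>n \<ge> 4\<close>: the path \<open>0, 1, 2, 3\<close> with pendant
  vertices \<open>4, \<dots>, n - 1\<close> attached to the vertex \<open>2\<close>.
\<close>

definition extremal_tree :: "nat \<Rightarrow> nat pair_pre_digraph" where
  "extremal_tree n =
     (let E = {(0, 1), (1, 2), (2, 3)} \<union> {(2, i) | i. 4 \<le> i \<and> i < n}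
      in \<lparr> pverts = {..<n}, parcs = E \<union> E\<inverse> \<rparr>)"

end

(*
  Call an edge uv of T dominating if every vertex is adjacent to u or to v. In the complement of T
  the ends of a dominating edge have distance 3, the ends of any other edge distance 2.

  If T has a dominating edge, then it is a double star with p and q leaves, p + q = n - 2, and
  p, q > 0 as T is not a star. The eccentricity matrix of the complement is the weighted adjacency
  matrix with weight 3 on the central edge and 2 on the others; the squares t of its nonzero
  eigenvalues satisfy (t - 4p) (t - 4q) = 9t. The larger root of this equation decreases in pq, so
  it is largest precisely if p = 1 or q = 1.

  Otherwise the matrix is twice the adjacency matrix of T. Evaluating its square at an entry of
  maximal modulus of an eigenvector bounds the squares of the eigenvalues by 4 times the largest
  number of walks of length 2 from a vertex, which is at most n - 1 as T has no cycles of length 3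
  and 4. At t = 4 (n - 1) the polynomial (t - 4p) (t - 4q) - 9t for p = 1 is negative.
*)

theory Submission
  imports Defs "Jordan_Normal_Form.Spectral_Radius"
begin

section \<open>Real symmetric matrices\<close>

text \<open>The Hermitian form \<open>Q\<close> of a real symmetric matrix at an eigenvector is real
  and equals \<open>k * N\<close>, where \<open>N\<close> is the squared norm, a positive
  real.\<close>

lemma symmetric_eigenvalue_real:
  fixes A :: "real mat"
  assumes A: "A \<in> carrier_mat n n"
    and sym: "\<And>i j. i < n \<Longrightarrow> j < n \<Longrightarrow> A $$ (i, j) = A $$ (j, i)"
    and ev: "eigenvalue (map_mat complex_of_real A) k"
  shows "cnj k = k"
proof -
  obtain v where v: "v \<in> carrier_vec n" "v \<noteq> 0\<^sub>v n"
    and eq: "map_mat complex_of_real A *\<^sub>v v = k \<cdot>\<^sub>v v"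
    using ev A by (auto simp: eigenvalue_def eigenvector_def)
  have row: "(\<Sum>j<n. of_real (A $$ (i, j)) * v $ j) = k * v $ i" if "i < n" for i
  proof -
    have "(map_mat complex_of_real A *\<^sub>v v) $ i = (k \<cdot>\<^sub>v v) $ i" using eq by simp
    then show ?thesis
      using that v A by (simp add: scalar_prod_def lessThan_atLeast0)
  qed
  define Q where "Q = (\<Sum>i<n. \<Sum>j<n. of_real (A $$ (i, j)) * v $ j * cnj (v $ i))"
  define N where "N = (\<Sum>i<n. v $ i * cnj (v $ i))"
  have "cnj Q = (\<Sum>i<n. \<Sum>j<n. of_real (A $$ (j, i)) * v $ i * cnj (v $ j))"
    unfolding Q_def cnj_sum by (intro sum.cong refl) (auto simp: sym)
  also have "\<dots> = Q" unfolding Q_def by (rule sum.swap)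
  finally have Q: "cnj Q = Q" .
  have "Q = (\<Sum>i<n. (\<Sum>j<n. of_real (A $$ (i, j)) * v $ j) * cnj (v $ i))"
    unfolding Q_def by (simp add: sum_distrib_right)
  also have "\<dots> = k * N"
    unfolding N_def sum_distrib_left by (intro sum.cong) (auto simp: row)
  finally have QN: "Q = k * N" .
  have N: "N = of_real (\<Sum>i<n. (cmod (v $ i))\<^sup>2)"
    unfolding N_def by (simp add: complex_norm_square del: of_real_power)
  obtain i where "i < n" "v $ i \<noteq> 0"
    using v by (metis carrier_vecD eq_vecI index_zero_vec)
  then have "(\<Sum>i<n. (cmod (v $ i))\<^sup>2) > 0"
    by (intro sum_pos2[where i = i]) auto
  then have "N \<noteq> 0" unfolding N by (simp del: of_real_sum)
  moreover have "cnj N = N" unfolding N by simp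
  ultimately show ?thesis using Q QN by auto
qed

text \<open>Over the complex numbers an eigenvalue always exists. It is real by symmetry, and a real
  root of the complexified characteristic polynomial is a root of the real one.\<close>

lemma symmetric_ex_eigenvalue:
  fixes A :: "real mat"
  assumes A: "A \<in> carrier_mat n n" and n: "n > 0"
    and sym: "\<And>i j. i < n \<Longrightarrow> j < n \<Longrightarrow> A $$ (i, j) = A $$ (j, i)"
  shows "\<exists>k. eigenvalue A k"
proof -
  have A': "map_mat complex_of_real A \<in> carrier_mat n n" using A by simp
  obtain k where k: "eigenvalue (map_mat complex_of_real A) k"
    using spectrum_non_empty[OF A' n] by (auto simp: spectrum_def)
  have "cnj k = k" by (rule symmetric_eigenvalue_real[OF A sym k])
  then obtain r where r: "k = complex_of_real r" by (metis complex_cnj_cancel_iff Reals_cnj_iff Reals_cases)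
  have "poly (map_poly complex_of_real (char_poly A)) (of_real r) = 0"
    using k r eigenvalue_root_char_poly[OF A'] of_real_hom.char_poly_hom[OF A] by metis
  then have "poly (char_poly A) r = 0" by simp
  then show ?thesis using eigenvalue_root_char_poly[OF A] by blast
qed

section \<open>Eccentricity eigenvalues as functions on vertices\<close>

text \<open>Transport along the bijection between indices and vertices turns eigenvectors into
  functions on vertices, so that no enumeration is mentioned from here on.\<close>

lemma eigenvalue_ecc_matrix_iff:
  assumes "finite (pverts G)"
  shows "eigenvalue (ecc_matrix G) k \<longleftrightarrow>
    (\<exists>x. (\<exists>u\<in>pverts G. x u \<noteq> 0) \<and>
         (\<forall>u\<in>pverts G. (\<Sum>v\<in>pverts G. ecc_entry G u v * x v) = k * x u))"
    (is "_ \<longleftrightarrow> ?R")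
proof -
  obtain xs where xs: "distinct xs" "set xs = pverts G"
    using finite_distinct_list[OF assms] by auto
  define n where "n = length xs"
  have bij: "bij_betw ((!) xs) {..<n} (pverts G)"
    using bij_betw_nth[OF xs(1), of "{..<n}" "pverts G"] xs n_def by auto
  have dim: "dim_row (ecc_matrix_enum G xs) = n" by (simp add: ecc_matrix_enum_def n_def)
  have nth: "(ecc_matrix_enum G xs *\<^sub>v w) $ i = (\<Sum>j<n. ecc_entry G (xs ! i) (xs ! j) * w $ j)"
    if "i < n" "w \<in> carrier_vec n" for i w
    using that by (simp add: ecc_matrix_enum_def scalar_prod_def n_def[symmetric] lessThan_atLeast0)
  have "eigenvalue (ecc_matrix_enum G xs) k \<longleftrightarrow> ?R"
  proof
    assume "eigenvalue (ecc_matrix_enum G xs) k"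
    then obtain w where w: "w \<in> carrier_vec n" "w \<noteq> 0\<^sub>v n"
      and eq: "ecc_matrix_enum G xs *\<^sub>v w = k \<cdot>\<^sub>v w"
      unfolding eigenvalue_def eigenvector_def dim by blast
    define x where "x u = w $ (the_inv_into {..<n} ((!) xs) u)" for u
    have x: "x (xs ! i) = w $ i" if "i < n" for i
      using that the_inv_into_f_f[OF bij_betw_imp_inj_on[OF bij]] by (auto simp: x_def)
    obtain i where i: "i < n" "w $ i \<noteq> 0"
      using w by (metis carrier_vecD eq_vecI index_zero_vec)
    have "(\<Sum>v\<in>pverts G. ecc_entry G (xs ! i) v * x v) = k * x (xs ! i)" if "i < n" for i
    proof -
      have "(\<Sum>v\<in>pverts G. ecc_entry G (xs ! i) v * x v)
          = (\<Sum>j<n. ecc_entry G (xs ! i) (xs ! j) * x (xs ! j))"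
        by (rule sum.reindex_bij_betw[OF bij, symmetric])
      also have "\<dots> = (ecc_matrix_enum G xs *\<^sub>v w) $ i"
        using that w by (simp add: nth x)
      also have "\<dots> = k * x (xs ! i)" unfolding eq using that w by (simp add: x)
      finally show ?thesis .
    qed
    then have "\<forall>u\<in>pverts G. (\<Sum>v\<in>pverts G. ecc_entry G u v * x v) = k * x u"
      unfolding bij_betw_imp_surj_on[OF bij, symmetric] by blast
    moreover have "x (xs ! i) \<noteq> 0" "xs ! i \<in> pverts G"
      using i x bij_betw_imp_surj_on[OF bij] by auto
    ultimately show ?R by blast
  next
    assume ?R
    then obtain x u where u: "u \<in> pverts G" "x u \<noteq> 0"
      and eq: "\<And>u. u \<in> pverts G \<Longrightarrow> (\<Sum>v\<in>pverts G. ecc_entry G u v * x v) = k * x u"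
      by blast
    define w where "w = vec n (\<lambda>i. x (xs ! i))"
    obtain i where i: "i < n" "u = xs ! i"
      using u bij_betw_imp_surj_on[OF bij] by auto
    then have "w $ i \<noteq> 0" using u by (simp add: w_def)
    then have "w \<noteq> 0\<^sub>v n" using i by auto
    moreover have "ecc_matrix_enum G xs *\<^sub>v w = k \<cdot>\<^sub>v w"
    proof (rule eq_vecI)
      fix i assume "i < dim_vec (k \<cdot>\<^sub>v w)"
      then have i: "i < n" by (simp add: w_def)
      have "(ecc_matrix_enum G xs *\<^sub>v w) $ i
          = (\<Sum>j<n. ecc_entry G (xs ! i) (xs ! j) * x (xs ! j))"
        using i by (simp add: nth w_def)
      also have "\<dots> = (\<Sum>v\<in>pverts G. ecc_entry G (xs ! i) v * x v)"
        by (rule sum.reindex_bij_betw[OF bij])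
      also have "\<dots> = k * x (xs ! i)" using eq[of "xs ! i"] i xs(2) n_def nth_mem[of i xs] by simp
      finally show "(ecc_matrix_enum G xs *\<^sub>v w) $ i = (k \<cdot>\<^sub>v w) $ i"
        using i by (simp add: w_def)
    qed (simp add: dim w_def)
    ultimately show "eigenvalue (ecc_matrix_enum G xs) k"
      unfolding eigenvalue_def eigenvector_def dim by (intro exI[of _ w]) (auto simp: w_def)
  qed
  then show ?thesis
    using eigenvalue_ecc_matrix_enum[of G xs] xs by (simp add: vertex_enum_def)
qed

text \<open>Finiteness is half of what makes the \<open>Min\<close> in
  \<open>least_ecc_eigenvalue\<close> an actual minimum; the other half is that an eigenvalue
  exists.\<close>

lemma finite_ecc_eigenvalues:
  "finite {k. eigenvalue (ecc_matrix G) k}"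
  unfolding ecc_matrix_def ecc_matrix_enum_def
  using card_finite_spectrum(1)[unfolded spectrum_def] by (metis mat_carrier)

text \<open>Serves the trees without a dominating edge, for which no eigenvector is written down
  explicitly.\<close>

lemma ex_ecc_eigenvalue:
  assumes fin: "finite (pverts G)" and ne: "pverts G \<noteq> {}"
    and sym: "\<And>u v. u \<in> pverts G \<Longrightarrow> v \<in> pverts G \<Longrightarrow> ecc_entry G u v = ecc_entry G v u"
  shows "\<exists>k. eigenvalue (ecc_matrix G) k"
proof -
  obtain xs where xs: "distinct xs" "set xs = pverts G"
    using finite_distinct_list[OF fin] by auto
  have "\<exists>k. eigenvalue (ecc_matrix_enum G xs) k"
  proof (rule symmetric_ex_eigenvalue)
    show "ecc_matrix_enum G xs \<in> carrier_mat (length xs) (length xs)"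
      by (simp add: ecc_matrix_enum_def)
    show "length xs > 0" using xs ne by auto
  next
    fix i j assume "i < length xs" "j < length xs"
    then show "ecc_matrix_enum G xs $$ (i, j) = ecc_matrix_enum G xs $$ (j, i)"
      using sym[of "xs ! i" "xs ! j"] xs nth_mem by (auto simp: ecc_matrix_enum_def)
  qed
  then show ?thesis
    using eigenvalue_ecc_matrix_enum[of G xs] xs by (auto simp: vertex_enum_def)
qed

section \<open>Distances in the complement\<close>

text \<open>With unit weights the cost of a walk is its length, and the infimum defining
  \<open>\<mu>\<close> is attained by \<open>p\<close>.\<close>

lemma graph_dist_eqI:
  assumes "pair_wf_digraph G"
    and "pre_digraph.awalk (with_proj G) u p v" "length p = n"
    and "\<And>q. pre_digraph.awalk (with_proj G) u q v \<Longrightarrow> n \<le> length q"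
  shows "graph_dist G u v = n"
proof -
  interpret pair_wf_digraph G by fact
  have cost: "awalk_cost (\<lambda>_. 1) p = length p" for p :: "('a \<times> 'a) list"
    by (induction p) auto
  have "\<mu> (\<lambda>_. 1) u v = ereal n"
    unfolding \<mu>_def cost
    by (rule INF_eqI) (use assms in \<open>force+\<close>)
  then show ?thesis by (simp add: graph_dist_def)
qed

context pair_graph
begin

lemma graph_dist_self: "u \<in> pverts G \<Longrightarrow> graph_dist G u u = 0"
  using graph_dist_eqI[of G u "[]" u 0] by (auto simp: awalk_Nil_iff)

lemma graph_dist_adj:
  assumes "(u, v) \<in> parcs G"
  shows "graph_dist G u v = 1"
proof -
  have "u \<noteq> v" using assms no_loops' by blast
  then have "1 \<le> length q" if "awalk u q v" for q
    using that by (cases q) (auto simp: awalk_Nil_iff)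
  then show ?thesis
    using graph_dist_eqI[of G u "[(u, v)]" v 1] assms
    by (auto simp: awalk_simps dest: in_arcsD1 in_arcsD2)
qed

lemma graph_dist_2:
  assumes "u \<noteq> v" "(u, v) \<notin> parcs G" "(u, w) \<in> parcs G" "(w, v) \<in> parcs G"
  shows "graph_dist G u v = 2"
proof -
  have "2 \<le> length q" if "awalk u q v" for q
  proof (rule ccontr)
    assume "\<not> 2 \<le> length q"
    then consider "q = []" | e where "q = [e]"
      by (cases q; cases "tl q") auto
    then show False
      using that assms(1,2) by cases (auto simp: awalk_simps)
  qed
  then show ?thesis
    using graph_dist_eqI[of G u "[(u, w), (w, v)]" v 2] assms
    by (auto simp: awalk_simps dest: in_arcsD1 in_arcsD2)
qed

lemma graph_dist_3:
  assumes "u \<noteq> v" "(u, v) \<notin> parcs G" "\<And>w. (u, w) \<in> parcs G \<Longrightarrow> (w, v) \<notin> parcs G"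
    and "(u, a) \<in> parcs G" "(a, b) \<in> parcs G" "(b, v) \<in> parcs G"
  shows "graph_dist G u v = 3"
proof -
  have "3 \<le> length q" if "awalk u q v" for q
  proof (rule ccontr)
    assume "\<not> 3 \<le> length q"
    then consider "q = []" | e where "q = [e]" | e e' where "q = [e, e']"
      by (cases q; cases "tl q"; cases "tl (tl q)") auto
    then show False
      using that assms(1-3) by cases (auto simp: awalk_simps)
  qed
  then show ?thesis
    using graph_dist_eqI[of G u "[(u, a), (a, b), (b, v)]" v 3] assms
    by (auto simp: awalk_simps dest: in_arcsD1 in_arcsD2)
qed

end

lemma graph_complement_simps [simp]:
  "pverts (graph_complement G) = pverts G"
  "(u, v) \<in> parcs (graph_complement G) \<longleftrightarrow>
     u \<in> pverts G \<and> v \<in> pverts G \<and> u \<noteq> v \<and> (u, v) \<notin> parcs G"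
  by (auto simp: graph_complement_def)

context pair_graph
begin

lemma graph_dist_complement_nonadj:
  assumes "u \<in> pverts G" "v \<in> pverts G" "(u, v) \<notin> parcs G"
  shows "graph_dist (graph_complement G) u v = (if u = v then 0 else 1)"
proof -
  interpret C: pair_graph "graph_complement G"
    by (rule pair_graph_graph_complement) (rule pair_graph)
  show ?thesis
    using assms C.graph_dist_self[of u] C.graph_dist_adj[of u v] by auto
qed

text \<open>The path \<open>u\<close>, \<open>w\<close>, \<open>v\<close> runs in the complement.
  Here \<open>w\<close> differs from both ends, since each end is adjacent in \<open>G\<close> to
  the other but not to \<open>w\<close>.\<close>

lemma graph_dist_complement_adj:
  assumes "(u, v) \<in> parcs G" "w \<in> pverts G" "(u, w) \<notin> parcs G" "(v, w) \<notin> parcs G"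
  shows "graph_dist (graph_complement G) u v = 2"
proof -
  interpret C: pair_graph "graph_complement G"
    by (rule pair_graph_graph_complement) (rule pair_graph)
  have "(v, u) \<in> parcs G" "(w, v) \<notin> parcs G" using assms arcs_symmetric by blast+
  then show ?thesis
    using assms in_arcsD1 in_arcsD2 no_loops' by (intro C.graph_dist_2[of u v w]) auto
qed

lemma eccentricity_eqI:
  assumes "\<And>v. v \<in> pverts G \<Longrightarrow> graph_dist H u v \<le> c"
    and "w \<in> pverts G" "graph_dist H u w = c" "pverts H = pverts G"
  shows "eccentricity H u = c"
  unfolding eccentricity_def using assms pair_finite_verts by (intro Max_eqI) auto

text \<open>Distances in the complement are at most 2, with 2 exactly on the edges of
  \<open>G\<close>. As every vertex has a neighbour, all eccentricities are 2, so precisely the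
  edges contribute.\<close>

lemma ecc_entry_complement_undominated:
  assumes nbr: "\<And>u. u \<in> pverts G \<Longrightarrow> \<exists>v. (u, v) \<in> parcs G"
    and undom: "\<And>u v. (u, v) \<in> parcs G \<Longrightarrow> \<exists>w\<in>pverts G. (u, w) \<notin> parcs G \<and> (v, w) \<notin> parcs G"
    and uv: "u \<in> pverts G" "v \<in> pverts G"
  shows "ecc_entry (graph_complement G) u v = (if (u, v) \<in> parcs G then 2 else 0)"
proof -
  have adj: "graph_dist (graph_complement G) u v = 2" if "(u, v) \<in> parcs G" for u v
    using undom[OF that] graph_dist_complement_adj[OF that] by blast
  have ecc: "eccentricity (graph_complement G) u = 2" if u: "u \<in> pverts G" for u
  proof -
    obtain w where "(u, w) \<in> parcs G" using nbr u by blast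
    then show ?thesis
      using adj[of u] graph_dist_complement_nonadj[OF u] in_arcsD2[of u w]
      by (intro eccentricity_eqI[where w = w]) (simp_all add: order.order_iff_strict, fastforce)
  qed
  show ?thesis
    using uv adj[of u v] graph_dist_complement_nonadj[OF uv] by (simp add: ecc_entry_def ecc)
qed

end

section \<open>Double stars\<close>

text \<open>\<open>A\<close> and \<open>B\<close> are the leaves at the centres \<open>u\<close> and
  \<open>v\<close>. Requiring both to be nonempty excludes stars, whose centre is isolated in the
  complement.\<close>

definition double_star :: "'a pair_pre_digraph \<Rightarrow> 'a \<Rightarrow> 'a \<Rightarrow> 'a set \<Rightarrow> 'a set \<Rightarrow> bool" where
  "double_star G u v A B \<longleftrightarrow>
     finite A \<and> finite B \<and> A \<noteq> {} \<and> B \<noteq> {} \<and> A \<inter> B = {} \<and>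
     u \<noteq> v \<and> u \<notin> A \<union> B \<and> v \<notin> A \<union> B \<and> pverts G = {u, v} \<union> A \<union> B \<and>
     (let E = {(u, v)} \<union> {u} \<times> A \<union> {v} \<times> B in parcs G = E \<union> E\<inverse>)"

lemma double_star_swap: "double_star G u v A B \<Longrightarrow> double_star G v u B A"
  unfolding double_star_def Let_def by auto

lemma double_star_pair_graph:
  assumes "double_star G u v A B"
  shows "pair_graph G"
  using assms unfolding double_star_def Let_def
  by unfold_locales (auto simp: symmetric_def sym_def)

text \<open>In the complement the centres have eccentricity 3 and the leaves 2, so only
  centre-to-centre distance 3 and centre-to-own-leaf distance 2 survive. The rows of
  \<open>v\<close> and \<open>B\<close> follow by \<open>double_star_swap\<close>.\<close>

lemma double_star_ecc_entry_left:
  assumes ds: "double_star G u v A B"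
  shows "x \<in> A \<Longrightarrow> y \<in> pverts G \<Longrightarrow>
      ecc_entry (graph_complement G) x y = (if y = u then 2 else 0)"
    and "y \<in> pverts G \<Longrightarrow>
      ecc_entry (graph_complement G) u y = (if y = v then 3 else if y \<in> A then 2 else 0)"
proof -
  have disj: "u \<noteq> v" "u \<notin> A" "u \<notin> B" "v \<notin> A" "v \<notin> B" "A \<noteq> {}" "B \<noteq> {}"
    and V: "pverts G = {u, v} \<union> A \<union> B"
    using ds by (auto simp: double_star_def)
  have AB: "x \<in> A \<Longrightarrow> x \<notin> B" for x using ds by (auto simp: double_star_def)
  have Eu: "(u, y) \<in> parcs G \<longleftrightarrow> y = v \<or> y \<in> A" and Ev: "(v, y) \<in> parcs G \<longleftrightarrow> y = u \<or> y \<in> B"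
    and EA: "x \<in> A \<Longrightarrow> (x, y) \<in> parcs G \<longleftrightarrow> y = u"
    and EB: "x \<in> B \<Longrightarrow> (x, y) \<in> parcs G \<longleftrightarrow> y = v" for x y
    using ds unfolding double_star_def Let_def by auto
  have inV: "u \<in> pverts G" "v \<in> pverts G" "x \<in> A \<Longrightarrow> x \<in> pverts G" "x \<in> B \<Longrightarrow> x \<in> pverts G" for x
    unfolding V by auto
  let ?C = "graph_complement G"
  interpret pair_graph G by (rule double_star_pair_graph[OF ds])
  interpret C: pair_graph ?C
    by (rule pair_graph_graph_complement) (rule pair_graph)
  obtain a b where ab: "a \<in> A" "b \<in> B" using disj by auto
  \<comment> \<open>A leaf of the opposite centre is adjacent neither to \<open>u\<close> nor to
    \<open>x\<close>.\<close>
  have uA: "graph_dist ?C u x = 2" "graph_dist ?C x u = 2" if "x \<in> A" for x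
    by (rule graph_dist_complement_adj[where w = b]; use that ab disj AB in \<open>auto simp: inV Eu EA\<close>)+
  have vB: "graph_dist ?C v x = 2" "graph_dist ?C x v = 2" if "x \<in> B" for x
    by (rule graph_dist_complement_adj[where w = a]; use that ab disj AB in \<open>auto simp: inV Ev EB\<close>)+
  \<comment> \<open>The shortest path in the complement is \<open>u\<close>, \<open>b\<close>,
    \<open>a\<close>, \<open>v\<close>: each centre misses exactly the leaves of the other
    one.\<close>
  have uv: "graph_dist ?C u v = 3"
    by (rule C.graph_dist_3[where a = b and b = a])
      (use ab disj AB EA in \<open>auto simp: inV Eu Ev EA EB V\<close>)
  have vu: "graph_dist ?C v u = 3"
    by (rule C.graph_dist_3[where a = a and b = b])
      (use ab disj AB EA in \<open>auto simp: inV Eu Ev EA EB V\<close>)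
  have non: "graph_dist ?C x y = (if x = y then 0 else 1)"
    if "x \<in> pverts G" "y \<in> pverts G" "(x, y) \<notin> parcs G" for x y
    using that by (rule graph_dist_complement_nonadj)
  have u_dist: "graph_dist ?C u y = (if y = u then 0 else if y = v then 3 else if y \<in> A then 2 else 1)"
    if "y \<in> pverts G" for y
    using uv uA(1)[of y] non[OF inV(1) that] by (simp only: Eu) (metis disj(1,2))
  have v_dist: "graph_dist ?C v y = (if y = v then 0 else if y = u then 3 else if y \<in> B then 2 else 1)"
    if "y \<in> pverts G" for y
    using vu vB(1)[of y] non[OF inV(2) that] by (simp only: Ev) (metis disj(1,5))
  have A_dist: "graph_dist ?C x y = (if y = u then 2 else if y = x then 0 else 1)"
    if "x \<in> A" "y \<in> pverts G" for x y
    using uA(2)[OF that(1)] non[OF inV(3)[OF that(1)] that(2)] by (simp only: EA[OF that(1)]) metis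
  have B_dist: "graph_dist ?C x y = (if y = v then 2 else if y = x then 0 else 1)"
    if "x \<in> B" "y \<in> pverts G" for x y
    using vB(2)[OF that(1)] non[OF inV(4)[OF that(1)] that(2)] by (simp only: EB[OF that(1)]) metis
  have eu: "eccentricity ?C u = 3" using inV disj
    by (intro eccentricity_eqI[where w = v]) (auto simp: u_dist)
  have ev: "eccentricity ?C v = 3" using inV disj
    by (intro eccentricity_eqI[where w = u]) (auto simp: v_dist)
  have eA: "eccentricity ?C x = 2" if "x \<in> A" for x using inV that
    by (intro eccentricity_eqI[where w = u]) (auto simp: A_dist)
  have eB: "eccentricity ?C x = 2" if "x \<in> B" for x using inV that
    by (intro eccentricity_eqI[where w = v]) (auto simp: B_dist)
  have ecc: "eccentricity ?C y = (if y = u \<or> y = v then 3 else 2)" if "y \<in> pverts G" for y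
    using that eu ev eA eB by (auto simp: V)
  show "ecc_entry ?C x y = (if y = u then 2 else 0)" if "x \<in> A" "y \<in> pverts G"
    using uA(2)[OF that(1)] that(1) disj
    by (auto simp add: ecc_entry_def A_dist[OF that] eA[OF that(1)] ecc[OF that(2)])
  show "ecc_entry ?C u y = (if y = v then 3 else if y \<in> A then 2 else 0)" if "y \<in> pverts G"
    using disj uv by (auto simp add: ecc_entry_def u_dist[OF that] eu ecc[OF that])
qed

lemma double_star_sum:
  assumes "double_star G u v A B"
  shows "sum f (pverts G) = f u + f v + sum f A + (sum f B :: real)"
proof -
  have "pverts G = insert u (insert v (A \<union> B))" "finite A" "finite B"
    "A \<inter> B = {}" "u \<noteq> v" "u \<notin> A \<union> B" "v \<notin> A \<union> B"
    using assms by (auto simp: double_star_def)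
  then show ?thesis by (simp add: sum.union_disjoint)
qed

lemma double_star_row_left:
  assumes ds: "double_star G u v A B"
  shows "a \<in> A \<Longrightarrow> (\<Sum>y\<in>pverts G. ecc_entry (graph_complement G) a y * x y) = 2 * x u"
    and "(\<Sum>y\<in>pverts G. ecc_entry (graph_complement G) u y * x y) = 3 * x v + 2 * sum x A"
proof -
  have fin: "finite (pverts G)" and u: "u \<in> pverts G"
    and *: "u \<noteq> v" "u \<notin> A" "v \<notin> A" "\<And>y. y \<in> B \<Longrightarrow> y \<noteq> v \<and> y \<notin> A"
    using ds by (auto simp: double_star_def)
  show "(\<Sum>y\<in>pverts G. ecc_entry (graph_complement G) a y * x y) = 2 * x u" if "a \<in> A"
  proof -
    have "(\<Sum>y\<in>pverts G. ecc_entry (graph_complement G) a y * x y)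
        = (\<Sum>y\<in>pverts G. if y = u then 2 * x y else 0)"
      by (intro sum.cong refl) (simp add: double_star_ecc_entry_left(1)[OF ds that])
    then show ?thesis using fin u by simp
  qed
  let ?f = "\<lambda>y. (if y = v then 3 else if y \<in> A then 2 else 0) * x y"
  have "(\<Sum>y\<in>pverts G. ecc_entry (graph_complement G) u y * x y) = sum ?f (pverts G)"
    by (intro sum.cong refl) (simp add: double_star_ecc_entry_left(2)[OF ds])
  also have "\<dots> = ?f u + ?f v + sum ?f A + sum ?f B" by (rule double_star_sum[OF ds])
  also have "sum ?f A = (\<Sum>y\<in>A. 2 * x y)" using * by (intro sum.cong) auto
  also have "sum ?f B = 0" using * by (intro sum.neutral) auto
  finally show "(\<Sum>y\<in>pverts G. ecc_entry (graph_complement G) u y * x y) = 3 * x v + 2 * sum x A"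
    using * by (simp add: sum_distrib_left)
qed

text \<open>The larger root of \<open>t\<^sup>2 - (4(p + q) + 9) t + 16pq = (t - 4p)(t - 4q) - 9t\<close>.\<close>

definition double_star_root :: "real \<Rightarrow> real \<Rightarrow> real" where
  "double_star_root p q =
     ((4 * (p + q) + 9) + sqrt ((4 * (p + q) + 9)\<^sup>2 - 64 * (p * q))) / 2"

lemma double_star_discriminant_pos:
  fixes p q :: real
  assumes "0 \<le> p" "0 \<le> q"
  shows "(4 * (p + q) + 9)\<^sup>2 - 64 * (p * q) > 0"
proof -
  have "(4 * (p + q) + 9)\<^sup>2 - 64 * (p * q) = 16 * (p - q)\<^sup>2 + 72 * (p + q) + 81"
    by (simp add: power2_eq_square algebra_simps)
  then show ?thesis using assms by (simp add: add_nonneg_pos)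
qed

lemma double_star_root_eq:
  assumes "0 \<le> p" "0 \<le> q"
  shows "(double_star_root p q - 4 * p) * (double_star_root p q - 4 * q) = 9 * double_star_root p q"
proof -
  define s where "s = 4 * (p + q) + 9"
  define D where "D = s\<^sup>2 - 64 * (p * q)"
  have "sqrt D * sqrt D = D"
    using double_star_discriminant_pos[OF assms] by (simp add: D_def s_def)
  moreover have "2 * double_star_root p q - s = sqrt D"
    by (simp add: double_star_root_def D_def s_def field_simps)
  ultimately have "(2 * double_star_root p q - s) * (2 * double_star_root p q - s) = s * s - 64 * (p * q)"
    by (simp only: D_def power2_eq_square)
  then show ?thesis by (simp add: s_def algebra_simps)
qed

text \<open>Multiplying by 4 and completing the square isolates \<open>t\<close>: a quadratic with
  positive leading coefficient is nonpositive only up to its larger root.\<close>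

lemma double_star_root_greatest:
  assumes "0 \<le> p" "0 \<le> q" and t: "(t - 4 * p) * (t - 4 * q) \<le> 9 * t"
  shows "t \<le> double_star_root p q"
proof -
  define s where "s = 4 * (p + q) + 9"
  have "(2 * t - s)\<^sup>2 \<le> s\<^sup>2 - 64 * (p * q)"
    using t by (simp add: s_def power2_eq_square algebra_simps)
  then have "2 * t - s \<le> sqrt (s\<^sup>2 - 64 * (p * q))" by (rule real_le_rsqrt)
  then show ?thesis by (simp add: double_star_root_def s_def)
qed

lemma double_star_root_nonneg:
  assumes "0 \<le> p" "0 \<le> q"
  shows "0 \<le> double_star_root p q"
  \<comment> \<open>At the test point \<open>4 * p\<close> the product vanishes.\<close>
  using double_star_root_greatest[OF assms, of "4 * p"] assms by simp

text \<open>For a fixed sum only the product varies, and it enters negatively under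
  \<open>sqrt\<close>, which is strictly increasing on all reals.\<close>

lemma double_star_root_compare:
  fixes p q p' q' :: real
  assumes "p' + q' = p + q"
  shows "double_star_root p q < double_star_root p' q' \<longleftrightarrow> p' * q' < p * q"
    and "double_star_root p q = double_star_root p' q' \<longleftrightarrow> p' * q' = p * q"
  using assms by (simp_all add: double_star_root_def) auto

section \<open>Spectrum of the complement of a double star\<close>

text \<open>Multiplying the rows of the centres by \<open>k\<close> eliminates the leaf values. The
  remaining homogeneous system in \<open>x u\<close> and \<open>x v\<close> has a nonzero solution,
  which forces the quadratic equation for \<open>k\<^sup>2\<close>.\<close>

lemma double_star_eigenvalue_bound:
  assumes ds: "double_star G u v A B" and ev: "eigenvalue (ecc_matrix (graph_complement G)) k"
  shows "k\<^sup>2 \<le> double_star_root (card A) (card B)"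
proof (cases "k = 0")
  case True
  then show ?thesis by (simp add: double_star_root_nonneg)
next
  case k: False
  let ?p = "real (card A)" and ?q = "real (card B)"
  note ds' = double_star_swap[OF ds]
  have fin: "finite (pverts G)" and V: "pverts G = {u, v} \<union> A \<union> B"
    using ds by (auto simp: double_star_def)
  from ev obtain x where x: "\<exists>w\<in>pverts G. x w \<noteq> 0"
    and eq: "\<And>w. w \<in> pverts G \<Longrightarrow> (\<Sum>y\<in>pverts G. ecc_entry (graph_complement G) w y * x y) = k * x w"
    using eigenvalue_ecc_matrix_iff[of "graph_complement G" k] fin by auto
  have A: "2 * x u = k * x a" if "a \<in> A" for a
    using eq[of a] that V double_star_row_left(1)[OF ds that, of x] by simp
  have B: "2 * x v = k * x b" if "b \<in> B" for b
    using eq[of b] that V double_star_row_left(1)[OF ds' that, of x] by simp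
  have u: "3 * x v + 2 * sum x A = k * x u"
    using eq[of u] V double_star_row_left(2)[OF ds, of x] by simp
  have v: "3 * x u + 2 * sum x B = k * x v"
    using eq[of v] V double_star_row_left(2)[OF ds', of x] by simp
  have "k * sum x A = (\<Sum>a\<in>A. 2 * x u)" unfolding sum_distrib_left using A by (intro sum.cong) auto
  then have sA: "k * sum x A = 2 * ?p * x u" by simp
  have "k * sum x B = (\<Sum>b\<in>B. 2 * x v)" unfolding sum_distrib_left using B by (intro sum.cong) auto
  then have sB: "k * sum x B = 2 * ?q * x v" by simp
  have "k * (3 * x v + 2 * sum x A) = k * (k * x u)" using u by simp
  then have u': "(k\<^sup>2 - 4 * ?p) * x u = 3 * k * x v"
    using sA by (simp add: power2_eq_square algebra_simps)
  have "k * (3 * x u + 2 * sum x B) = k * (k * x v)" using v by simp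
  then have v': "(k\<^sup>2 - 4 * ?q) * x v = 3 * k * x u"
    using sB by (simp add: power2_eq_square algebra_simps)
  \<comment> \<open>If \<open>x\<close> vanished at both centres, then \<open>k \<noteq> 0\<close>
    would make it vanish at all leaves.\<close>
  have "x u \<noteq> 0 \<or> x v \<noteq> 0" using x A B k V by fastforce
  moreover have "(k\<^sup>2 - 4 * ?p) * (k\<^sup>2 - 4 * ?q) * x u = 9 * k\<^sup>2 * x u"
  proof -
    have "(k\<^sup>2 - 4 * ?p) * (k\<^sup>2 - 4 * ?q) * x u = (k\<^sup>2 - 4 * ?q) * (3 * k * x v)"
      unfolding u'[symmetric] by (simp only: mult_ac)
    also have "\<dots> = 3 * k * ((k\<^sup>2 - 4 * ?q) * x v)" by (simp only: mult_ac)
    also have "\<dots> = 9 * k\<^sup>2 * x u" unfolding v' by (simp add: power2_eq_square)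
    finally show ?thesis .
  qed
  moreover have "(k\<^sup>2 - 4 * ?p) * (k\<^sup>2 - 4 * ?q) * x v = 9 * k\<^sup>2 * x v"
  proof -
    have "(k\<^sup>2 - 4 * ?p) * (k\<^sup>2 - 4 * ?q) * x v = (k\<^sup>2 - 4 * ?p) * (3 * k * x u)"
      unfolding v'[symmetric] by (simp only: mult_ac)
    also have "\<dots> = 3 * k * ((k\<^sup>2 - 4 * ?p) * x u)" by (simp only: mult_ac)
    also have "\<dots> = 9 * k\<^sup>2 * x v" unfolding u' by (simp add: power2_eq_square)
    finally show ?thesis .
  qed
  ultimately have "(k\<^sup>2 - 4 * ?p) * (k\<^sup>2 - 4 * ?q) = 9 * k\<^sup>2" by auto
  then show ?thesis by (intro double_star_root_greatest) auto
qed

text \<open>The bound on \<open>k\<^sup>2\<close> is attained by a negative eigenvalue, with an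
  explicit eigenvector.\<close>

lemma double_star_eigenvalue:
  assumes ds: "double_star G u v A B"
  shows "eigenvalue (ecc_matrix (graph_complement G)) (- sqrt (double_star_root (card A) (card B)))"
proof -
  let ?p = "real (card A)" and ?q = "real (card B)"
  define \<mu> where "\<mu> = double_star_root ?p ?q"
  define k where "k = - sqrt \<mu>"
  have \<mu>: "(\<mu> - 4 * ?p) * (\<mu> - 4 * ?q) = 9 * \<mu>" unfolding \<mu>_def by (rule double_star_root_eq) auto
  have "card A > 0" using ds by (auto simp: double_star_def card_gt_0_iff)
  moreover have "4 * ?p \<le> \<mu>" unfolding \<mu>_def by (rule double_star_root_greatest) auto
  ultimately have "\<mu> > 0" by linarith
  then have kk: "k * k = \<mu>" and k: "k \<noteq> 0" by (auto simp: k_def)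
  note ds' = double_star_swap[OF ds]
  have fin: "finite (pverts G)" and V: "pverts G = {u, v} \<union> A \<union> B"
    and *: "u \<noteq> v" "u \<notin> A" "u \<notin> B" "v \<notin> A" "v \<notin> B" "\<And>y. y \<in> B \<Longrightarrow> y \<notin> A"
    using ds by (auto simp: double_star_def)
  \<comment> \<open>The centre values solve \<open>(k\<^sup>2 - 4 * ?p) * x u = 3 * k * x v\<close>;
    the leaf rows then force \<open>2 * x u / k = 6\<close> on \<open>A\<close> and
    \<open>2 * x v / k\<close> on \<open>B\<close>.\<close>
  define x where "x y = (if y = u then 3 * k else if y = v then \<mu> - 4 * ?p
     else if y \<in> A then 6 else 2 * (\<mu> - 4 * ?p) / k)" for y
  have xA: "x a = 6" if "a \<in> A" for a using * that by (auto simp: x_def)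
  have xB: "x b = 2 * (\<mu> - 4 * ?p) / k" if "b \<in> B" for b using * that by (auto simp: x_def)
  have xu: "x u = 3 * k" and xv: "x v = \<mu> - 4 * ?p" using * by (auto simp: x_def)
  have "(\<Sum>y\<in>pverts G. ecc_entry (graph_complement G) w y * x y) = k * x w" if "w \<in> pverts G" for w
  proof -
    from that V consider "w = u" | "w = v" | "w \<in> A" | "w \<in> B" by auto
    then show ?thesis
    proof cases
      case 1
      have "sum x A = 6 * ?p" by (simp add: xA)
      then show ?thesis using 1 kk by (simp add: double_star_row_left(2)[OF ds] xu xv)
    next
      case 2
      have "sum x B = ?q * (2 * (\<mu> - 4 * ?p) / k)" by (simp add: xB)
      \<comment> \<open>The row of \<open>v\<close> is the only one that uses the quadratic equation
        for \<open>\<mu>\<close>, reached after multiplying by \<open>k\<close>.\<close>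
      moreover have "3 * (3 * k) + 2 * (?q * (2 * (\<mu> - 4 * ?p) / k)) = k * (\<mu> - 4 * ?p)"
      proof -
        have "k * (3 * (3 * k) + 2 * (?q * (2 * (\<mu> - 4 * ?p) / k))) = 9 * (k * k) + 4 * ?q * (\<mu> - 4 * ?p)"
          using k by (simp add: field_simps)
        also have "\<dots> = k * (k * (\<mu> - 4 * ?p))"
          using \<mu> by (simp only: mult.assoc[symmetric] kk) (simp add: algebra_simps)
        finally show ?thesis using k by simp
      qed
      ultimately show ?thesis using 2 by (simp add: double_star_row_left(2)[OF ds'] xu xv)
    next
      case 3
      then show ?thesis by (simp add: double_star_row_left(1)[OF ds] xA xu)
    next
      case 4
      then show ?thesis using k by (simp add: double_star_row_left(1)[OF ds'] xB xv)
    qed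
  qed
  moreover have "u \<in> pverts G" "x u \<noteq> 0" using V xu k by auto
  ultimately have "eigenvalue (ecc_matrix (graph_complement G)) k"
    using eigenvalue_ecc_matrix_iff[of "graph_complement G" k] fin by auto
  then show ?thesis by (simp add: k_def \<mu>_def)
qed

lemma double_star_least_ecc_eigenvalue:
  assumes ds: "double_star G u v A B"
  shows "least_ecc_eigenvalue (graph_complement G) = - sqrt (double_star_root (card A) (card B))"
  unfolding least_ecc_eigenvalue_def
proof (rule Min_eqI)
  show "finite {k. eigenvalue (ecc_matrix (graph_complement G)) k}"
    by (rule finite_ecc_eigenvalues)
next
  fix k assume "k \<in> {k. eigenvalue (ecc_matrix (graph_complement G)) k}"
  then have "k\<^sup>2 \<le> double_star_root (card A) (card B)"
    using double_star_eigenvalue_bound[OF ds] by simp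
  then have "- k \<le> sqrt (double_star_root (card A) (card B))"
    by (intro real_le_rsqrt) simp
  then show "- sqrt (double_star_root (card A) (card B)) \<le> k" by simp
qed (use double_star_eigenvalue[OF ds] in simp)

section \<open>Double stars up to isomorphism\<close>

text \<open>The path end \<open>3\<close> joins the \<open>n - 4\<close> pendant vertices as a leaf
  at \<open>2\<close>, so the leaf counts are 1 and \<open>n - 3\<close>.\<close>

lemma extremal_tree_double_star:
  assumes "n \<ge> 4"
  shows "double_star (extremal_tree n) 1 2 {0} {3..<n}"
  using assms unfolding double_star_def extremal_tree_def Let_def by auto

text \<open>Centres go to centres, and leaves along arbitrary bijections between leaf sets of equal
  size.\<close>

lemma double_star_iso:
  assumes G: "double_star G u v A B" and H: "double_star H u' v' A' B'"
    and card: "card A = card A'" "card B = card B'"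
  shows "digraph_iso (with_proj G) (with_proj H)"
proof -
  interpret pair_graph G by (rule double_star_pair_graph[OF G])
  have dG: "u \<noteq> v" "u \<notin> A" "u \<notin> B" "v \<notin> A" "v \<notin> B" "A \<inter> B = {}"
    and V: "pverts G = {u, v} \<union> A \<union> B"
    and E: "parcs G = ({(u, v)} \<union> {u} \<times> A \<union> {v} \<times> B) \<union> ({(u, v)} \<union> {u} \<times> A \<union> {v} \<times> B)\<inverse>"
    using G by (auto simp: double_star_def Let_def)
  have dH: "u' \<noteq> v'" "u' \<notin> A'" "u' \<notin> B'" "v' \<notin> A'" "v' \<notin> B'" "A' \<inter> B' = {}"
    and V': "pverts H = {u', v'} \<union> A' \<union> B'"
    and E': "parcs H = ({(u', v')} \<union> {u'} \<times> A' \<union> {v'} \<times> B') \<union> ({(u', v')} \<union> {u'} \<times> A' \<union> {v'} \<times> B')\<inverse>"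
    using H by (auto simp: double_star_def Let_def)
  have fin: "finite A" "finite B" "finite A'" "finite B'"
    using G H by (auto simp: double_star_def)
  obtain g h where g: "bij_betw g A A'" and h: "bij_betw h B B'"
    using finite_same_card_bij card fin by metis
  define f where "f y = (if y = u then u' else if y = v then v' else if y \<in> A then g y else h y)" for y
  have fu: "f u = u'" and fv: "f v = v'" using dG by (auto simp: f_def)
  have fA: "f y = g y" if "y \<in> A" for y using that dG by (auto simp: f_def)
  have fB: "f y = h y" if "y \<in> B" for y using that dG by (auto simp: f_def)
  have bA: "bij_betw f A A'" using g by (simp add: fA cong: bij_betw_cong)
  have bB: "bij_betw f B B'" using h by (simp add: fB cong: bij_betw_cong)
  have iA: "f ` A = A'" and iB: "f ` B = B'" using bA bB by (auto simp: bij_betw_def)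
  have "bij_betw f (A \<union> B) (A' \<union> B')" by (rule bij_betw_combine[OF bA bB dH(6)])
  then have inj: "inj_on f (pverts G)"
    unfolding V using fu fv dH dG iA iB
    by (auto simp: bij_betw_def inj_on_insert image_Un Un_assoc)
  have "map_prod f f ` parcs G = parcs H"
    unfolding E E' iA[symmetric] iB[symmetric] fu[symmetric] fv[symmetric] by force
  moreover have "f ` pverts G = pverts H" unfolding V V' image_Un by (simp add: fu fv iA iB)
  moreover have "inj_on (map_prod f f) (parcs G)"
    using inj in_arcsD1 in_arcsD2 by (auto simp: inj_on_def)
  \<comment> \<open>An arc is the pair of its ends, so the vertex map \<open>f\<close> induces the
    arc map \<open>map_prod f f\<close>.\<close>
  ultimately have
    "digraph_isomorphism \<lparr>iso_verts = f, iso_arcs = map_prod f f, iso_head = snd, iso_tail = fst\<rparr>"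
    "with_proj H = app_iso \<lparr>iso_verts = f, iso_arcs = map_prod f f, iso_head = snd, iso_tail = fst\<rparr> G"
    using inj wf_digraph_axioms by (simp_all add: digraph_isomorphism_def app_iso_def with_proj_def[of H])
  then show ?thesis unfolding digraph_iso_def by blast
qed

text \<open>Yields that a graph isomorphic to the extremal tree has the same leaf counts, hence the
  same least eigenvalue.\<close>

lemma double_star_iso_image:
  assumes G: "double_star G u v A B" and iso: "digraph_iso (with_proj G) (with_proj H)"
  shows "\<exists>u' v' A' B'. double_star H u' v' A' B' \<and> card A' = card A \<and> card B' = card B"
proof -
  interpret pair_graph G by (rule double_star_pair_graph[OF G])
  obtain hom where hom: "digraph_isomorphism hom" and H: "with_proj H = app_iso hom (with_proj G)"
    using iso by (auto simp: digraph_iso_def)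
  define f where "f = iso_verts hom"
  have inj: "inj_on f (pverts G)"
    using digraph_isomorphism_inj_on_verts[OF hom] by (simp add: f_def)
  have V: "pverts H = f ` pverts G"
    using arg_cong[OF H, of verts] by (simp add: f_def)
  have "parcs H = (\<lambda>(u, v). (f u, f v)) ` parcs G"
    using arcs_ends_app_iso_eq[OF hom] H[symmetric] by (simp add: f_def)
  then have pH: "parcs H = map_prod f f ` parcs G" by (auto simp: map_prod_def)
  have fin: "finite A" "finite B" "A \<noteq> {}" "B \<noteq> {}" "A \<inter> B = {}"
    and *: "u \<noteq> v" "u \<notin> A" "u \<notin> B" "v \<notin> A" "v \<notin> B"
    and VG: "pverts G = {u, v} \<union> A \<union> B"
    and E: "parcs G = ({(u, v)} \<union> {u} \<times> A \<union> {v} \<times> B) \<union> ({(u, v)} \<union> {u} \<times> A \<union> {v} \<times> B)\<inverse>"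
    using G by (auto simp: double_star_def Let_def)
  have "f ` A \<inter> f ` B = {}"
    using inj_on_image_Int[OF inj, of A B] VG fin by auto
  moreover have "f u \<noteq> f v" using inj_on_eq_iff[OF inj, of u v] VG * by simp
  moreover have "f u \<notin> f ` A" "f u \<notin> f ` B" "f v \<notin> f ` A" "f v \<notin> f ` B"
    using inj_on_image_mem_iff[OF inj] VG * by auto
  moreover have "pverts H = {f u, f v} \<union> f ` A \<union> f ` B" using V VG by auto
  moreover have "parcs H = ({(f u, f v)} \<union> {f u} \<times> f ` A \<union> {f v} \<times> f ` B)
      \<union> ({(f u, f v)} \<union> {f u} \<times> f ` A \<union> {f v} \<times> f ` B)\<inverse>"
    unfolding pH E by force
  ultimately have "double_star H (f u) (f v) (f ` A) (f ` B)"
    using fin by (simp add: double_star_def)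
  moreover have "card (f ` A) = card A" "card (f ` B) = card B"
    using inj VG by (auto intro!: card_image elim: inj_on_subset)
  ultimately show ?thesis by blast
qed

section \<open>Trees\<close>

lemma undirected_tree_no_triangle:
  assumes T: "undirected_tree T" and "(x, y) \<in> parcs T" "(y, z) \<in> parcs T"
  shows "(z, x) \<notin> parcs T"
proof
  assume "(z, x) \<in> parcs T"
  interpret pair_graph T using T by (simp add: undirected_tree_def)
  have "cycle [(x, y), (y, z), (z, x)]"
    unfolding cycle_def using assms(2,3) \<open>(z, x) \<in> parcs T\<close> no_loops' in_arcsD1
    by (auto simp: awalk_simps)
  moreover have "length [(x, y), (y, z), (z, x)] \<ge> 3" by simp
  ultimately show False using T unfolding undirected_tree_def by blast
qed

text \<open>Consecutive corners differ since there are no loops; the two opposite pairs are assumed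
  distinct, as otherwise the closed walk could just retrace edges.\<close>

lemma undirected_tree_no_4_cycle:
  assumes T: "undirected_tree T" and "(x, y) \<in> parcs T" "(y, z) \<in> parcs T" "(z, w) \<in> parcs T"
    and "x \<noteq> z" "y \<noteq> w"
  shows "(w, x) \<notin> parcs T"
proof
  assume "(w, x) \<in> parcs T"
  interpret pair_graph T using T by (simp add: undirected_tree_def)
  have "cycle [(x, y), (y, z), (z, w), (w, x)]"
    unfolding cycle_def using assms(2-) \<open>(w, x) \<in> parcs T\<close> no_loops' in_arcsD1
    by (auto simp: awalk_simps)
  moreover have "length [(x, y), (y, z), (z, w), (w, x)] \<ge> 3" by simp
  ultimately show False using T unfolding undirected_tree_def by blast
qed

text \<open>A walk to any second vertex starts with an arc out of \<open>u\<close>.\<close>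

lemma undirected_tree_neighbour:
  assumes T: "undirected_tree T" and "card (pverts T) \<ge> 2" "u \<in> pverts T"
  shows "\<exists>v. (u, v) \<in> parcs T"
proof -
  interpret pair_graph T using T by (simp add: undirected_tree_def)
  have "strongly_connected T"
    using T sym_arcs symmetric_connected_imp_strongly_connected by (auto simp: undirected_tree_def)
  moreover obtain v where v: "v \<in> pverts T" "v \<noteq> u"
  proof -
    have "\<not> pverts T \<subseteq> {u}" using assms(2) card_mono[of "{u}" "pverts T"] by auto
    then show ?thesis using that by blast
  qed
  ultimately obtain p where p: "awalk u p v"
    using assms(3) by (auto simp: strongly_connected_def reachable_awalk)
  then show ?thesis using v by (cases p) (auto simp: awalk_simps)
qed

text \<open>In a graph without triangles and 4-cycles, sending a walk \<open>u, w, z\<close> to \<open>z\<close> if \<open>z \<noteq> u\<close>, and to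
  \<open>w\<close> otherwise, is injective.\<close>

lemma card_2_walks_le:
  assumes T: "undirected_tree T" and u: "u \<in> pverts T"
  shows "card (SIGMA w:{w. (u, w) \<in> parcs T}. {z. (w, z) \<in> parcs T}) \<le> card (pverts T) - 1"
proof -
  interpret pair_graph T using T by (simp add: undirected_tree_def)
  note sym = arcs_symmetric
  let ?P = "SIGMA w:{w. (u, w) \<in> parcs T}. {z. (w, z) \<in> parcs T}"
  let ?f = "\<lambda>(w, z). if z = u then w else z"
  have "inj_on ?f ?P"
  proof (rule inj_onI)
    fix e e' assume "e \<in> ?P" "e' \<in> ?P" and eq: "?f e = ?f e'"
    then obtain w z w' z' where e: "e = (w, z)" "e' = (w', z')"
      and E: "(u, w) \<in> parcs T" "(w, z) \<in> parcs T" "(u, w') \<in> parcs T" "(w', z') \<in> parcs T"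
      by auto
    have tri: False if "(u, a) \<in> parcs T" "(a, b) \<in> parcs T" "(u, b) \<in> parcs T" for a b
      using undirected_tree_no_triangle[OF T that(1,2)] sym[OF that(3)] by blast
    \<comment> \<open>Different middle vertices would close the 4-cycle \<open>u\<close>,
      \<open>w\<close>, \<open>z\<close>, \<open>w'\<close>.\<close>
    have "w = w'" if "z = z'" "z \<noteq> u"
      using undirected_tree_no_4_cycle[OF T E(1,2), of w'] sym[OF E(4)] sym[OF E(3)] that by blast
    \<comment> \<open>If just one of the walks returns to \<open>u\<close>, equal images give a
      triangle: the middle vertex of that walk is the end of the other.\<close>
    then show "e = e'"
      using eq E tri[of w' z'] tri[of w z] by (auto simp: e split: if_splits)
  qed
  \<comment> \<open>The value \<open>u\<close> is never taken, as \<open>w = u\<close> would be a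
    loop; this accounts for the \<open>- 1\<close>.\<close>
  moreover have "?f ` ?P \<subseteq> pverts T - {u}"
    using in_arcsD2 no_loops'[of u u] by (auto split: if_splits)
  ultimately have "card ?P \<le> card (pverts T - {u})"
    using pair_finite_verts by (intro card_inj_on_le[of ?f]) auto
  then show ?thesis using u pair_finite_verts by simp
qed

section \<open>Trees without a dominating edge\<close>

text \<open>Applying the eigenvalue equation twice expresses \<open>k\<^sup>2 * x u\<close> as 4
  times the sum of \<open>x\<close> over the ends of the 2-walks from \<open>u\<close>. For
  \<open>\<bar>x u\<bar>\<close> maximal, each term is at most \<open>\<bar>x u\<bar>\<close> in
  modulus, and \<open>card_2_walks_le\<close> counts the terms.\<close>

lemma undominated_tree_eigenvalue_bound:
  assumes T: "undirected_tree T" and n: "card (pverts T) \<ge> 2"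
    and undom: "\<And>u v. (u, v) \<in> parcs T \<Longrightarrow> \<exists>w\<in>pverts T. (u, w) \<notin> parcs T \<and> (v, w) \<notin> parcs T"
    and ev: "eigenvalue (ecc_matrix (graph_complement T)) k"
  shows "k\<^sup>2 \<le> 4 * (real (card (pverts T)) - 1)"
proof -
  interpret pair_graph T using T by (simp add: undirected_tree_def)
  let ?N = "\<lambda>w. {z. (w, z) \<in> parcs T}"
  have finN: "finite (?N w)" for w
    using in_arcsD2 by (intro finite_subset[OF _ pair_finite_verts]) auto
  from ev obtain x where x: "\<exists>w\<in>pverts T. x w \<noteq> 0"
    and eq: "\<And>w. w \<in> pverts T \<Longrightarrow>
      (\<Sum>y\<in>pverts T. ecc_entry (graph_complement T) w y * x y) = k * x w"
    using eigenvalue_ecc_matrix_iff[of "graph_complement T" k] pair_finite_verts by auto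
  have row: "2 * sum x (?N w) = k * x w" if w: "w \<in> pverts T" for w
  proof -
    have "k * x w = (\<Sum>y\<in>pverts T. if (w, y) \<in> parcs T then 2 * x y else 0)"
      unfolding eq[OF w, symmetric]
      by (intro sum.cong refl)
        (simp add: ecc_entry_complement_undominated[OF undirected_tree_neighbour[OF T n] undom w])
    also have "\<dots> = (\<Sum>y\<in>{y \<in> pverts T. (w, y) \<in> parcs T}. 2 * x y)"
      using pair_finite_verts by (simp add: sum.If_cases Int_def)
    also have "{y \<in> pverts T. (w, y) \<in> parcs T} = ?N w" using in_arcsD2 by auto
    finally show ?thesis by (simp add: sum_distrib_left)
  qed
  have "pverts T \<noteq> {}" using x by auto
  then have "Max ((\<lambda>w. \<bar>x w\<bar>) ` pverts T) \<in> (\<lambda>w. \<bar>x w\<bar>) ` pverts T"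
    using pair_finite_verts by (intro Max_in) auto
  then obtain u where u: "u \<in> pverts T" and "Max ((\<lambda>w. \<bar>x w\<bar>) ` pverts T) = \<bar>x u\<bar>"
    by (rule imageE)
  then have max: "\<bar>x w\<bar> \<le> \<bar>x u\<bar>" if "w \<in> pverts T" for w
    using Max_ge[of "(\<lambda>w. \<bar>x w\<bar>) ` pverts T" "\<bar>x w\<bar>"] that pair_finite_verts by simp
  have xu: "\<bar>x u\<bar> > 0" using x max by fastforce
  have "k\<^sup>2 * x u = 2 * (\<Sum>w\<in>?N u. k * x w)"
    using row[OF u] by (simp add: power2_eq_square sum_distrib_left[symmetric])
  also have "(\<Sum>w\<in>?N u. k * x w) = (\<Sum>w\<in>?N u. 2 * sum x (?N w))"
    using row in_arcsD2 by (intro sum.cong) auto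
  also have "2 * \<dots> = 4 * (\<Sum>w\<in>?N u. sum x (?N w))" by (simp add: sum_distrib_left)
  also have "(\<Sum>w\<in>?N u. sum x (?N w)) = (\<Sum>(w, z)\<in>Sigma (?N u) ?N. x z)"
    by (rule sum.Sigma) (use finN in auto)
  finally have "\<bar>k\<^sup>2 * x u\<bar> = \<bar>4 * (\<Sum>(w, z)\<in>Sigma (?N u) ?N. x z)\<bar>" by (rule arg_cong)
  then have "k\<^sup>2 * \<bar>x u\<bar> = 4 * \<bar>\<Sum>(w, z)\<in>Sigma (?N u) ?N. x z\<bar>" by (simp only: abs_mult) simp
  also have "\<bar>\<Sum>(w, z)\<in>Sigma (?N u) ?N. x z\<bar> \<le> (\<Sum>e\<in>Sigma (?N u) ?N. \<bar>x u\<bar>)"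
    by (rule order.trans[OF sum_abs sum_mono]) (use max in_arcsD2 in auto)
  also have "\<dots> = real (card (Sigma (?N u) ?N)) * \<bar>x u\<bar>" by simp
  also have "\<dots> \<le> (real (card (pverts T)) - 1) * \<bar>x u\<bar>"
    using card_2_walks_le[OF T u] n by (intro mult_right_mono) auto
  finally have "k\<^sup>2 * \<bar>x u\<bar> \<le> 4 * (real (card (pverts T)) - 1) * \<bar>x u\<bar>" by (simp only: mult.assoc)
  then show ?thesis using xu by (simp only: mult_le_cancel_right_pos)
qed

lemma undominated_tree_least_ecc_eigenvalue:
  assumes T: "undirected_tree T" and n: "card (pverts T) \<ge> 2"
    and undom: "\<And>u v. (u, v) \<in> parcs T \<Longrightarrow> \<exists>w\<in>pverts T. (u, w) \<notin> parcs T \<and> (v, w) \<notin> parcs T"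
  shows "- sqrt (4 * (real (card (pverts T)) - 1)) \<le> least_ecc_eigenvalue (graph_complement T)"
proof -
  interpret pair_graph T using T by (simp add: undirected_tree_def)
  let ?S = "{k. eigenvalue (ecc_matrix (graph_complement T)) k}"
  have ne: "pverts T \<noteq> {}" using n by auto
  have "\<exists>k. eigenvalue (ecc_matrix (graph_complement T)) k"
    using pair_finite_verts ne arcs_symmetric
    by (intro ex_ecc_eigenvalue)
      (auto simp: ecc_entry_complement_undominated[OF undirected_tree_neighbour[OF T n] undom])
  \<comment> \<open>The least eigenvalue must itself be an eigenvalue before the bound applies to
    it.\<close>
  then have "Min ?S \<in> ?S"
    by (intro Min_in finite_ecc_eigenvalues) auto
  then have "(- Min ?S)\<^sup>2 \<le> 4 * (real (card (pverts T)) - 1)"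
    using undominated_tree_eigenvalue_bound[OF T n undom] by simp
  then have "- Min ?S \<le> sqrt (4 * (real (card (pverts T)) - 1))" by (rule real_le_rsqrt)
  then show ?thesis by (simp add: least_ecc_eigenvalue_def)
qed

section \<open>Trees with a dominating edge\<close>

text \<open>Domination puts every other vertex next to \<open>u\<close> or \<open>v\<close>. The
  absence of triangles makes the two neighbour sets disjoint and independent, and the absence of
  4-cycles rules out edges between them.\<close>

lemma dominated_tree_double_star:
  assumes T: "undirected_tree T" and uv: "(u, v) \<in> parcs T"
    and dom: "\<And>w. w \<in> pverts T \<Longrightarrow> (u, w) \<in> parcs T \<or> (v, w) \<in> parcs T"
    and star: "\<not> K\<^bsub>1,card (pverts T) - 1\<^esub> (with_proj T)"
  shows "double_star T u v {w. (u, w) \<in> parcs T \<and> w \<noteq> v} {w. (v, w) \<in> parcs T \<and> w \<noteq> u}"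
    (is "double_star T u v ?A ?B")
proof -
  interpret pair_graph T using T by (simp add: undirected_tree_def)
  note sym = arcs_symmetric
  have V: "pverts T = {u, v} \<union> ?A \<union> ?B" using dom uv in_arcsD1 in_arcsD2 by auto
  have ne: "u \<noteq> v" using uv no_loops' by blast
  have tri: False if "(x, y) \<in> parcs T" "(y, z) \<in> parcs T" "(x, z) \<in> parcs T" for x y z
    using undirected_tree_no_triangle[OF T that(1,2)] sym[OF that(3)] by blast
  have disj: "?A \<inter> ?B = {}" using tri[OF uv] by blast
  have AB: False if "a \<in> ?A" "b \<in> ?B" "(a, b) \<in> parcs T" for a b
    using undirected_tree_no_4_cycle[OF T, of u a b v] that sym[OF uv] sym[of v b] by auto
  have EA: "(x, y) \<in> parcs T \<longleftrightarrow> y = u" if x: "x \<in> ?A" for x y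
  proof
    assume xy: "(x, y) \<in> parcs T"
    have "y \<noteq> v" "y \<notin> ?A" "y \<notin> ?B" using tri[of u x y] x xy uv AB by auto
    then show "y = u" using V in_arcsD2[OF xy] by blast
  qed (use x sym in auto)
  have EB: "(x, y) \<in> parcs T \<longleftrightarrow> y = v" if x: "x \<in> ?B" for x y
  proof
    assume xy: "(x, y) \<in> parcs T"
    have "y \<noteq> u" "y \<notin> ?B" "y \<notin> ?A" using tri[of v x y] x xy sym[OF uv] sym[OF xy] AB by auto
    then show "y = v" using V in_arcsD2[OF xy] by blast
  qed (use x sym in auto)
  have E: "parcs T = {(u, v), (v, u)} \<union> {u} \<times> ?A \<union> ?A \<times> {u} \<union> {v} \<times> ?B \<union> ?B \<times> {v}" (is "_ = ?R")
  proof (rule subset_antisym)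
    show "parcs T \<subseteq> ?R"
    proof (rule subrelI)
      fix x y assume xy: "(x, y) \<in> parcs T"
      then have "x \<in> {u, v} \<union> ?A \<union> ?B" using V in_arcsD1 by blast
      then show "(x, y) \<in> ?R" using xy EA[of x y] EB[of x y] by blast
    qed
    show "?R \<subseteq> parcs T" using uv sym by auto
  qed
  have fin: "finite ?A" "finite ?B"
    using finite_subset[OF _ pair_finite_verts] V by blast+
  define A B where "A = ?A" and "B = ?B"
  have E': "parcs T = {(u, v), (v, u)} \<union> {u} \<times> A \<union> A \<times> {u} \<union> {v} \<times> B \<union> B \<times> {v}"
    and V': "pverts T = {u, v} \<union> A \<union> B"
    unfolding A_def B_def by (rule E, rule V)
  have notin: "u \<notin> A" "u \<notin> B" "v \<notin> A" "v \<notin> B" using no_loops' by (auto simp: A_def B_def)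
  \<comment> \<open>If one leaf set were empty, its centre would be a leaf of the other centre and
    \<open>T\<close> would be a star.\<close>
  have not_star: "\<not> (pverts T = insert c C \<and> parcs T = {c} \<times> C \<union> C \<times> {c})" if "c \<notin> C" for c C
  proof
    assume c: "pverts T = insert c C \<and> parcs T = {c} \<times> C \<union> C \<times> {c}"
    then have "card C = card (pverts T) - 1" using that pair_finite_verts by simp
    then have "K\<^bsub>1,card (pverts T) - 1\<^esub> (with_proj T)"
      unfolding complete_bipartite_digraph_pair_def using that c pair_finite_verts
      by (intro conjI exI[of _ "{c}"] exI[of _ C]) simp_all
    then show False using star by simp
  qed
  have "A \<noteq> {}"
  proof
    assume "A = {}"
    then have "pverts T = insert v (insert u B)"
      and "parcs T = {v} \<times> insert u B \<union> insert u B \<times> {v}"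
      unfolding V' E' by auto
    then show False using not_star[of v "insert u B"] notin ne by blast
  qed
  moreover have "B \<noteq> {}"
  proof
    assume "B = {}"
    then have "pverts T = insert u (insert v A)"
      and "parcs T = {u} \<times> insert v A \<union> insert v A \<times> {u}"
      unfolding V' E' by auto
    then show False using not_star[of u "insert v A"] notin ne by blast
  qed
  moreover have "parcs T = (let E = {(u, v)} \<union> {u} \<times> A \<union> {v} \<times> B in E \<union> E\<inverse>)"
    unfolding Let_def E' by auto
  ultimately show ?thesis
    unfolding double_star_def A_def[symmetric] B_def[symmetric]
    using fin[folded A_def B_def] disj[folded A_def B_def] ne notin V' by simp
qed

section \<open>Comparison with the extremal tree\<close>

theorem theorem3p7:
  fixes T :: "'a pair_pre_digraph" and n :: nat
  assumes "n \<ge> 4"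
    and "undirected_tree T"
    and "card (pverts T) = n"
    and "\<not> K\<^bsub>1,n - 1\<^esub> T"
  shows "least_ecc_eigenvalue (graph_complement T)
           \<ge> least_ecc_eigenvalue (graph_complement (extremal_tree n)) \<and>
         (least_ecc_eigenvalue (graph_complement T)
           = least_ecc_eigenvalue (graph_complement (extremal_tree n))
          \<longleftrightarrow> digraph_iso T (extremal_tree n))"
proof -
  interpret pair_graph T using assms(2) by (simp add: undirected_tree_def)
  note ext = extremal_tree_double_star[OF assms(1)]
  define r where "r = double_star_root 1 (real (n - 3))"
  have least_ext: "least_ecc_eigenvalue (graph_complement (extremal_tree n)) = - sqrt r"
    using double_star_least_ecc_eigenvalue[OF ext] by (simp add: r_def)
  have iso_eq: "least_ecc_eigenvalue (graph_complement T) = - sqrt r"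
    if iso: "digraph_iso T (extremal_tree n)"
  proof -
    have "digraph_iso (extremal_tree n) T" by (rule digraph_iso_swap[OF _ iso]) unfold_locales
    then obtain u v A B where ds: "double_star T u v A B" and "card A = 1" "card B = n - 3"
      using double_star_iso_image[OF ext, of T] by auto
    then show ?thesis using double_star_least_ecc_eigenvalue[OF ds] by (simp add: r_def)
  qed
  show ?thesis
  proof (cases "\<exists>u v. (u, v) \<in> parcs T \<and> (\<forall>w\<in>pverts T. (u, w) \<in> parcs T \<or> (v, w) \<in> parcs T)")
    case True
    then obtain u v A B where ds: "double_star T u v A B"
      using dominated_tree_double_star[OF assms(2)] assms(3,4) by blast
    define p q where "p = card A" and "q = card B"
    \<comment> \<open>Summing the constant 1 over the vertices counts them.\<close>
    have pq: "p \<ge> 1" "q \<ge> 1" "p + q + 2 = n"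
      using ds double_star_sum[OF ds, of "\<lambda>_. 1"] assms(3)
      by (auto simp: p_def q_def double_star_def card_gt_0_iff Suc_le_eq)
    have least_T: "least_ecc_eigenvalue (graph_complement T) = - sqrt (double_star_root p q)"
      using double_star_least_ecc_eigenvalue[OF ds] by (simp add: p_def q_def)
    have sum: "1 + real (n - 3) = real p + real q" using pq by linarith
    \<comment> \<open>For the common sum \<open>n - 2\<close>, the excess over the extremal product
      is \<open>(p - 1) * (q - 1)\<close>, which is nonnegative and vanishes only if some centre has
      a single leaf.\<close>
    have prod: "real p * real q - 1 * real (n - 3) = (real p - 1) * (real q - 1)"
      using sum by (simp add: algebra_simps)
    have "0 \<le> (real p - 1) * (real q - 1)" using pq by (intro mult_nonneg_nonneg) auto
    then have ge: "1 * real (n - 3) \<le> real p * real q" using prod by linarith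
    have iff: "double_star_root p q = r \<longleftrightarrow> p = 1 \<or> q = 1"
      using double_star_root_compare(2)[of 1 "real (n - 3)" p q] sum prod by (auto simp: r_def)
    have le: "double_star_root p q \<le> r"
      using double_star_root_compare[of 1 "real (n - 3)" p q] sum ge by (auto simp: r_def le_less)
    have "digraph_iso T (extremal_tree n)" if "p = 1 \<or> q = 1"
    proof (cases "p = 1")
      case True
      then show ?thesis using pq by (intro double_star_iso[OF ds ext]) (auto simp: p_def q_def)
    next
      case False
      then show ?thesis using that pq
        by (intro double_star_iso[OF double_star_swap[OF ds] ext]) (auto simp: p_def q_def)
    qed
    then show ?thesis using le iff iso_eq by (auto simp: least_T least_ext)
  next
    case False
    then have bound: "- sqrt (4 * (real n - 1)) \<le> least_ecc_eigenvalue (graph_complement T)"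
      using undominated_tree_least_ecc_eigenvalue[OF assms(2)] assms(1,3) by auto
    have "4 * (real n - 1) < r"
    proof -
      \<comment> \<open>This is \<open>2 * t - s < sqrt (s\<^sup>2 - 64 * (p * q))\<close> for
        \<open>t = 4 * (n - 1)\<close>, \<open>p = 1\<close>, \<open>q = n - 3\<close> and
        \<open>s = 4 * (p + q) + 9 = 4 * n + 1\<close>. The quadratic has the value
        \<open>- (4 * n + 28)\<close> at \<open>t\<close>.\<close>
      have "8 * (real n - 1) - (4 * real n + 1) < sqrt ((4 * real n + 1)\<^sup>2 - 64 * (real n - 3))"
        using assms(1) by (intro real_less_rsqrt) (simp add: power2_eq_square algebra_simps)
      moreover have "r = ((4 * real n + 1) + sqrt ((4 * real n + 1)\<^sup>2 - 64 * (real n - 3))) / 2"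
        using assms(1) by (simp add: r_def double_star_root_def of_nat_diff algebra_simps)
      ultimately show ?thesis by (simp add: field_simps)
    qed
    then have "sqrt (4 * (real n - 1)) < sqrt r" by (rule real_sqrt_less_mono)
    then have "- sqrt r < least_ecc_eigenvalue (graph_complement T)" using bound by linarith
    \<comment> \<open>The inequality is strict, and an isomorphism would force equality, so both
      sides of the equivalence fail.\<close>
    then show ?thesis using iso_eq by (auto simp: least_ext)
  qed
qed

end
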